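(* Let $\mathcal S\subseteq\mathbb R^n$ be a state space and $\mathcal A\subseteq\mathbb R^m$ an action space, and consider the deterministic continuous-time controlled dynamical system $\dot s=F_s(s,a)$, $s\in\mathcal S$, $a\in\mathcal A$. Assume: (1) (Affine in the actions, Lipschitz) there exist Lipschitz functions $f_0,f_1,\ldots,f_m:\mathcal S\to\mathbb R^n$ such that $$F_s(s,a)=f_0(s)+\sum_{j=1}^m a_j f_j(s)\qquad\text{for all } s\in\mathcal S,\ a=(a_1,\dots,a_m)\in\mathcal A;$$ (2) (Independent action directions) $\operatorname{rank}\begin{bmatrix} f_1(s)&\cdots& f_m(s)\end{bmatrix}=m$ for all $s\in\mathcal S$. Then there exist a possibly infinite-dimensional real vector space $\mathcal Z$, an injective map (embedding) $E:\mathcal S\to\mathcal Z$, and linear operators $A:\mathcal Z\to\mathcal Z$, $B:\mathbb R^m\to\mathcal Z$ and $C:\mathcal Z\to\mathcal L(\mathbb R^m,\mathcal Z)$ such that, for $z=E(s)$ with $s$ evolving according to $\dot s=F_s(s,a)$, $$\dot z=Az+M(z)a,\qquad M(z)=B+Cz .$$ Moreover, the linear map $M(z):\mathbb R^m\to\mathcal Z$ is injective for every $z\in E(\mathcal S)$; equivalently, $$M(z)^{\top}M(z)\succ 0\qquad\text{for all } z\in E(\mathcal S).$$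
   Context: $\mathcal L(\mathbb R^m,\mathcal Z)$ denotes the space of linear maps $\mathbb R^m\to\mathcal Z$, and $Cz\in\mathcal L(\mathbb R^m,\mathcal Z)$ denotes the value of $C$ at $z$, so $M(z)=B+Cz$ is itself a linear map $\mathbb R^m\to\mathcal Z$. The operators $A$, $B$, $C$ are linear; no boundedness is asserted. The space $\mathcal Z$ is understood to carry an inner product, so that the derivative $\dot z$ and the transpose $M(z)^\top$ make sense: the equation $\dot z=Az+M(z)a$ means that whenever a trajectory $t\mapsto s(t)\in\mathcal S$ is differentiable at a time $t$ with $\dot s(t)=F_s(s(t),a(t))$ for an input $a(t)\in\mathcal A$, the curve $z(t)=E(s(t))$ is differentiable at $t$ and $\dot z(t)=Az(t)+M(z(t))a(t)$. The operator $M(z)^\top M(z)$ is the $m\times m$ Gram matrix with entries $\langle M(z)e_i,M(z)e_j\rangle_{\mathcal Z}$, where $e_1,\dots,e_m$ is the standard basis of $\mathbb R^m$, and $\succ 0$ means positive definite. *)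

theory Defs
  imports
    "HOL-Analysis.Analysis"
    "HOL-Algebra.Algebraic_Closure_Type"
    "Jordan_Normal_Form.Missing_VectorSpace"
begin

text \<open>
  HOL cannot quantify existentially over types, so a real inner product space is a record with an
  explicit carrier: the modules of \<open>HOL-Algebra\<close>, extended by an inner product. As for every
  module record, the inherited fields \<^term>\<open>mult\<close> and \<^term>\<open>one\<close> carry no meaning.
\<close>

abbreviation real_ring :: "real ring" where
  "real_ring \<equiv> ring_of_type_algebra"

record 'v ip_module = "(real, 'v) module" +
  ip :: "'v \<Rightarrow> 'v \<Rightarrow> real"

locale real_inner_product_space = VectorSpace.vectorspace real_ring Z
  for Z :: "('v, 'e) ip_module_scheme" (structure) +
  assumes ip_commute: "\<lbrakk>x \<in> carrier Z; y \<in> carrier Z\<rbrakk> \<Longrightarrow> ip Z x y = ip Z y x"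
    and ip_add_left: "\<lbrakk>x \<in> carrier Z; y \<in> carrier Z; w \<in> carrier Z\<rbrakk>
        \<Longrightarrow> ip Z (x \<oplus> y) w = ip Z x w + ip Z y w"
    and ip_smult_left: "\<lbrakk>x \<in> carrier Z; y \<in> carrier Z\<rbrakk> \<Longrightarrow> ip Z (c \<odot> x) y = c * ip Z x y"
    and ip_nonneg: "x \<in> carrier Z \<Longrightarrow> 0 \<le> ip Z x x"
    and ip_definite: "\<lbrakk>x \<in> carrier Z; ip Z x x = 0\<rbrakk> \<Longrightarrow> x = \<zero>"

definition ip_norm :: "('v, 'e) ip_module_scheme \<Rightarrow> 'v \<Rightarrow> real" where
  "ip_norm Z x = sqrt (ip Z x x)"

text \<open>
  The curve \<open>z\<close>, defined on the set of times \<open>T\<close>, is differentiable at \<open>t\<close> with derivative \<open>w\<close>: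
  the difference quotients along \<open>T\<close> converge to \<open>w\<close> in the norm of \<open>Z\<close>.
\<close>

definition has_velocity ::
    "('v, 'e) ip_module_scheme \<Rightarrow> (real \<Rightarrow> 'v) \<Rightarrow> 'v \<Rightarrow> real \<Rightarrow> real set \<Rightarrow> bool" where
  "has_velocity Z z w t T \<longleftrightarrow> z \<in> T \<rightarrow> carrier Z \<and> w \<in> carrier Z \<and>
     ((\<lambda>u. ip_norm Z (((1 / (u - t)) \<odot>\<^bsub>Z\<^esub> (z u \<ominus>\<^bsub>Z\<^esub> z t)) \<ominus>\<^bsub>Z\<^esub> w)) \<longlongrightarrow> 0) (at t within T)"

text \<open>A type of class \<^class>\<open>real_vector\<close>, such as \<^typ>\<open>real^'m\<close>, seen as a module record.\<close>

definition type_module :: "(real, 'a::real_vector) module" where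
  "type_module = \<lparr>carrier = UNIV, mult = (\<lambda>_ _. 0), one = 0, zero = 0, add = (+), smult = (*\<^sub>R)\<rparr>"

abbreviation linear_maps ::
    "(real, 'v, 'e) module_scheme \<Rightarrow> (real, 'w, 'd) module_scheme \<Rightarrow> ('v \<Rightarrow> 'w) set" where
  "linear_maps \<equiv> LinearCombinations.module_hom real_ring"

text \<open>
  The space of linear maps from \<^typ>\<open>'a\<close> to \<open>Z\<close> with the pointwise operations. Since the domain
  is a whole type, no extensionality restriction on the carrier is needed.
\<close>

definition linear_map_space ::
    "(real, 'v, 'e) module_scheme \<Rightarrow> (real, 'a::real_vector \<Rightarrow> 'v) module" where
  "linear_map_space Z =
     \<lparr>carrier = linear_maps type_module Z,
      mult = (\<lambda>_ _ _. \<zero>\<^bsub>Z\<^esub>), one = (\<lambda>_. \<zero>\<^bsub>Z\<^esub>), zero = (\<lambda>_. \<zero>\<^bsub>Z\<^esub>),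
      add = (\<lambda>g h v. g v \<oplus>\<^bsub>Z\<^esub> h v), smult = (\<lambda>c g v. c \<odot>\<^bsub>Z\<^esub> g v)\<rparr>"

definition gram_matrix ::
    "('v, 'e) ip_module_scheme \<Rightarrow> (real^'m \<Rightarrow> 'v) \<Rightarrow> real^'m^'m" where
  "gram_matrix Z L = (\<chi> i j. ip Z (L (axis i 1)) (L (axis j 1)))"

definition positive_definite :: "real^'m^'m \<Rightarrow> bool" where
  "positive_definite Q \<longleftrightarrow> transpose Q = Q \<and> (\<forall>x. x \<noteq> 0 \<longrightarrow> 0 < x \<bullet> (Q *v x))"

end

theory Submission
  imports Defs "HOL-Library.Function_Algebras"
begin

text \<open>
  Send \<open>s\<close> to the exponential \<open>x \<mapsto> exp (s \<bullet> x)\<close> on the unit cube, in the space of continuous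
  functions with the \<open>L\<^sup>2\<close> inner product. This curve of functions is differentiable in \<open>s\<close> with
  injective derivative. Exponentials with distinct frequencies are linearly independent, and no
  boundedness is required of the operators, so their values on the image of the embedding can be
  prescribed freely: \<open>A\<close> sends the exponential of \<open>s\<close> to its derivative in direction \<open>f\<^sub>0 s\<close>,
  \<open>C\<close> sends it to the derivatives in the directions \<open>f\<^sub>j s\<close>, and \<open>B = 0\<close>.
\<close>

section \<open>Gram matrices of injective linear maps\<close>

text \<open>The quadratic form of the Gram matrix at \<open>x\<close> is the squared norm of
  \<open>L x\<close>; injectivity and definiteness of the inner product make it positive for nonzero
  \<open>x\<close>.\<close>

lemma (in real_inner_product_space) positive_definite_gram_matrix:
  assumes L: "L \<in> linear_maps type_module Z" and inj: "inj L"
  shows "positive_definite (gram_matrix Z L)"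
proof -
  have carrier: "L x \<in> carrier Z" for x
    using L by (auto simp: module_hom_def type_module_def)
  have L_add: "L (x + y) = L x \<oplus> L y" and L_scale: "L (c *\<^sub>R x) = c \<odot> L x" for x y c
    using L by (auto simp: module_hom_def type_module_def ring_of_type_algebra_def)
  have lin: "linear (\<lambda>x. ip Z (L x) w)" if "w \<in> carrier Z" for w
    by (rule linearI) (simp_all add: L_add L_scale carrier that ip_add_left ip_smult_left)
  have expand: "ip Z (L x) w = (\<Sum>i\<in>UNIV. x $ i * ip Z (L (axis i 1)) w)"
    if "w \<in> carrier Z" for x w
  proof -
    have "ip Z (L x) w = ip Z (L (\<Sum>i\<in>UNIV. (x $ i) *\<^sub>R axis i 1)) w"
      using basis_expansion[of x] by (simp add: scalar_mult_eq_scaleR)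
    also have "\<dots> = (\<Sum>i\<in>UNIV. x $ i * ip Z (L (axis i 1)) w)"
      by (simp add: linear_sum[OF lin[OF that]] linear_cmul[OF lin[OF that]])
    finally show ?thesis .
  qed
  have quadratic: "x \<bullet> (gram_matrix Z L *v x) = ip Z (L x) (L x)" for x
  proof -
    have "ip Z (L x) (L x) = (\<Sum>i\<in>UNIV. x $ i * ip Z (L x) (L (axis i 1)))"
      by (subst expand) (simp_all add: carrier ip_commute)
    also have "\<dots> = (\<Sum>i\<in>UNIV. x $ i * (\<Sum>j\<in>UNIV. x $ j * ip Z (L (axis j 1)) (L (axis i 1))))"
      by (intro sum.cong refl arg_cong2[where f = "(*)"] expand carrier)
    also have "\<dots> = x \<bullet> (gram_matrix Z L *v x)"
      by (simp add: inner_vec_def matrix_vector_mult_def gram_matrix_def ip_commute carrier mult_ac)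
    finally show ?thesis by simp
  qed
  have "L 0 = \<zero>"
    using L_scale[of 0 0] carrier[of 0] smult_l_null[of "L 0"]
    by (simp add: ring_of_type_algebra_def)
  then have "L x \<noteq> \<zero>" if "x \<noteq> 0" for x
    using inj that by (metis injD)
  then have "0 < ip Z (L x) (L x)" if "x \<noteq> 0" for x
    using that ip_definite ip_nonneg carrier by (metis less_eq_real_def)
  moreover have "transpose (gram_matrix Z L) = gram_matrix Z L"
    by (simp add: transpose_def gram_matrix_def vec_eq_iff ip_commute carrier)
  ultimately show ?thesis
    by (simp add: positive_definite_def quadratic)
qed

section \<open>Continuous functions on the unit cube with the inner product of L2\<close>

abbreviation unit_cube :: "'a::euclidean_space set" where
  "unit_cube \<equiv> cbox 0 One"

lemma box_unit_cube_ne: "box 0 (One :: 'a::euclidean_space) \<noteq> {}"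
  by (simp add: box_ne_empty)

text \<open>
  Setting the functions to zero off the cube makes the \<open>L\<^sup>2\<close> inner product definite.
\<close>

definition cube_functions :: "('a::euclidean_space \<Rightarrow> real) set" where
  "cube_functions = {g. continuous_on unit_cube g \<and> (\<forall>x. x \<notin> unit_cube \<longrightarrow> g x = 0)}"

definition cube_space :: "('a::euclidean_space \<Rightarrow> real) ip_module" where
  "cube_space = \<lparr>carrier = cube_functions, mult = (\<lambda>_ _ _. 0), one = (\<lambda>_. 0), zero = (\<lambda>_. 0),
     add = (\<lambda>g h x. g x + h x), smult = (\<lambda>c g x. c * g x),
     ip = (\<lambda>g h. integral unit_cube (\<lambda>x. g x * h x))\<rparr>"

lemma cube_space_simps [simp]:
  "carrier cube_space = cube_functions" "\<zero>\<^bsub>cube_space\<^esub> = (\<lambda>_. 0)"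
  "g \<oplus>\<^bsub>cube_space\<^esub> h = (\<lambda>x. g x + h x)" "c \<odot>\<^bsub>cube_space\<^esub> g = (\<lambda>x. c * g x)"
  "ip cube_space g h = integral unit_cube (\<lambda>x. g x * h x)"
  by (simp_all add: cube_space_def)

lemma cube_functions_zero: "(\<lambda>_. 0) \<in> cube_functions"
  by (simp add: cube_functions_def)

lemma cube_functions_add:
  "\<lbrakk>g \<in> cube_functions; h \<in> cube_functions\<rbrakk> \<Longrightarrow> (\<lambda>x. g x + h x) \<in> cube_functions"
  by (auto simp: cube_functions_def intro: continuous_intros)

lemma cube_functions_scale: "g \<in> cube_functions \<Longrightarrow> (\<lambda>x. c * g x) \<in> cube_functions"
  by (auto simp: cube_functions_def intro: continuous_intros)

lemma cube_functions_sum: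
  "(\<And>i. i \<in> I \<Longrightarrow> g i \<in> cube_functions) \<Longrightarrow> (\<lambda>x. \<Sum>i\<in>I. g i x) \<in> cube_functions"
  by (auto simp: cube_functions_def intro: continuous_intros)

lemma integrable_mult_cube_functions:
  "\<lbrakk>g \<in> cube_functions; h \<in> cube_functions\<rbrakk> \<Longrightarrow> (\<lambda>x. g x * h x) integrable_on unit_cube"
  by (auto simp: cube_functions_def intro!: integrable_continuous continuous_intros)

lemma real_inner_product_space_cube_space:
  "real_inner_product_space (cube_space :: ('a::euclidean_space \<Rightarrow> real) ip_module)"
proof -
  have field: "Ring.field real_ring"
    by (rule field_from_type_algebra)
  interpret R: Ring.field real_ring
    by (rule field)
  have neg: "(\<lambda>x. - g x) \<in> cube_functions" if "g \<in> cube_functions" for g :: "'a \<Rightarrow> real"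
    using cube_functions_scale[OF that, of "-1"] by simp
  have "abelian_group (cube_space :: ('a \<Rightarrow> real) ip_module)"
  proof (rule abelian_groupI)
    fix g :: "'a \<Rightarrow> real"
    assume "g \<in> carrier cube_space"
    then show "\<exists>h\<in>carrier cube_space. h \<oplus>\<^bsub>cube_space\<^esub> g = \<zero>\<^bsub>cube_space\<^esub>"
      using neg[of g] by (intro bexI[of _ "\<lambda>x. - g x"]) auto
  qed (simp_all add: cube_functions_zero cube_functions_add add_ac)
  then have module: "Module.module real_ring (cube_space :: ('a \<Rightarrow> real) ip_module)"
    by (intro Module.moduleI R.is_cring)
       (simp_all add: ring_of_type_algebra_def cube_functions_scale algebra_simps)
  show ?thesis
  proof (intro real_inner_product_space.intro VectorSpace.vectorspace.intro module field
      real_inner_product_space_axioms.intro)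
    fix g h k :: "'a \<Rightarrow> real" and c :: real
    assume g: "g \<in> carrier cube_space"
    then have cont: "continuous_on unit_cube (\<lambda>x. g x * g x)"
      by (auto simp: cube_functions_def intro: continuous_intros)
    show "0 \<le> ip cube_space g g"
      using g by (auto intro!: Henstock_Kurzweil_Integration.integral_nonneg
          integrable_mult_cube_functions)
    show "g = \<zero>\<^bsub>cube_space\<^esub>" if "ip cube_space g g = 0"
    proof -
      \<comment> \<open>A nonnegative continuous function with integral zero over a box with
        interior vanishes on the box; off the cube \<open>g\<close> is zero by membership in the
        carrier.\<close>
      have "\<forall>x\<in>unit_cube. g x * g x = 0"
        using that integral_cbox_eq_0_iff[OF cont box_unit_cube_ne] by simp
      then show ?thesis
        using g by (auto simp: cube_functions_def)
    qed
    assume h: "h \<in> carrier cube_space"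
    show "ip cube_space g h = ip cube_space h g"
      by (simp add: mult.commute)
    show "ip cube_space (c \<odot>\<^bsub>cube_space\<^esub> g) h = c * ip cube_space g h"
      by (simp add: mult.assoc)
    assume k: "k \<in> carrier cube_space"
    show "ip cube_space (g \<oplus>\<^bsub>cube_space\<^esub> h) k = ip cube_space g k + ip cube_space h k"
      using g h k
      by (simp add: distrib_right Henstock_Kurzweil_Integration.integral_add
          integrable_mult_cube_functions)
  qed
qed

text \<open>Subtraction in the record goes through its abstract additive inverse, which uniqueness
  of inverses identifies with the pointwise negative.\<close>

lemma minus_cube_space:
  assumes g: "g \<in> cube_functions" and h: "h \<in> cube_functions"
  shows "g \<ominus>\<^bsub>cube_space\<^esub> h = (\<lambda>x. g x - h x)"
proof -
  interpret Z: real_inner_product_space cube_space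
    by (rule real_inner_product_space_cube_space)
  have "\<ominus>\<^bsub>cube_space\<^esub> h = (\<lambda>x. - h x)"
    using h cube_functions_scale[OF h, of "-1"] by (intro Z.minus_equality) auto
  then show ?thesis
    by (simp add: a_minus_def)
qed

text \<open>The cube has volume 1, so a uniform bound on it also bounds the norm. Convergence in
  norm thereby reduces to uniform convergence on the cube.\<close>

lemma ip_norm_cube_space_le:
  fixes g :: "'a::euclidean_space \<Rightarrow> real"
  assumes g: "g \<in> cube_functions" and bound: "\<And>x. x \<in> unit_cube \<Longrightarrow> \<bar>g x\<bar> \<le> b"
  shows "ip_norm cube_space g \<le> b"
proof -
  have "0 \<le> b"
    using bound[of 0] by (force simp: mem_box)
  have "integral unit_cube (\<lambda>x. g x * g x) \<le> integral unit_cube (\<lambda>x :: 'a. b\<^sup>2)"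
  proof (rule Henstock_Kurzweil_Integration.integral_le)
    fix x :: 'a
    assume "x \<in> unit_cube"
    then have "\<bar>g x\<bar> * \<bar>g x\<bar> \<le> b * b"
      by (intro mult_mono) (use bound \<open>0 \<le> b\<close> in auto)
    then show "g x * g x \<le> b\<^sup>2"
      by (simp add: power2_eq_square flip: abs_mult)
  qed (use g in \<open>auto intro: integrable_mult_cube_functions\<close>)
  also have "\<dots> = b\<^sup>2"
    by simp
  finally show ?thesis
    using \<open>0 \<le> b\<close> by (simp add: ip_norm_def real_le_lsqrt)
qed

section \<open>Exponentials and their derivative in the frequency\<close>

definition cube_exp :: "'a::euclidean_space \<Rightarrow> 'a \<Rightarrow> real" where
  "cube_exp s x = (if x \<in> unit_cube then exp (s \<bullet> x) else 0)"

text \<open>The derivative of \<open>cube_exp\<close> at the frequency \<open>s\<close> in direction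
  \<open>v\<close>.\<close>

definition cube_exp_deriv :: "'a::euclidean_space \<Rightarrow> 'a \<Rightarrow> 'a \<Rightarrow> real" where
  "cube_exp_deriv s v x = (v \<bullet> x) * cube_exp s x"

lemma cube_exp_in_cube_functions: "cube_exp s \<in> cube_functions"
proof -
  have "continuous_on unit_cube (\<lambda>x. exp (s \<bullet> x))"
    by (intro continuous_intros)
  then have "continuous_on unit_cube (cube_exp s)"
    by (rule continuous_on_eq) (simp add: cube_exp_def)
  then show ?thesis
    by (simp add: cube_functions_def cube_exp_def)
qed

lemma cube_exp_deriv_in_cube_functions: "cube_exp_deriv s v \<in> cube_functions"
  using cube_exp_in_cube_functions[of s]
  by (auto simp: cube_functions_def cube_exp_deriv_def [abs_def] intro!: continuous_intros)

lemma Basis_in_unit_cube: "b \<in> Basis \<Longrightarrow> b \<in> unit_cube"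
  by (auto simp: mem_box inner_Basis)

text \<open>The basis vectors lie in the cube, and the values there determine the coordinates of the
  frequency.\<close>

lemma inj_cube_exp: "inj cube_exp"
proof (rule injI, rule euclidean_eqI)
  fix s s' b :: 'a
  assume "cube_exp s = cube_exp s'" and "b \<in> Basis"
  then have "exp (s \<bullet> b) = exp (s' \<bullet> b)"
    by (metis Basis_in_unit_cube cube_exp_def)
  then show "s \<bullet> b = s' \<bullet> b"
    by simp
qed

lemma inj_cube_exp_deriv: "inj (cube_exp_deriv s)"
proof (rule injI, rule euclidean_eqI)
  fix v w b :: 'a
  assume "cube_exp_deriv s v = cube_exp_deriv s w" and b: "b \<in> Basis"
  then have "(v \<bullet> b) * cube_exp s b = (w \<bullet> b) * cube_exp s b"
    by (metis cube_exp_deriv_def)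
  then show "v \<bullet> b = w \<bullet> b"
    using b by (simp add: cube_exp_def Basis_in_unit_cube)
qed

text \<open>A remainder estimate of order o(h). Multiplying \<open>1 - h \<le> exp (- h)\<close> by
  \<open>exp h\<close> gives the upper bound; the remainder is nonnegative by
  \<open>1 + h \<le> exp h\<close>.\<close>

lemma exp_minus_linear_bound:
  fixes h :: real
  shows "\<bar>exp h - 1 - h\<bar> \<le> \<bar>h\<bar> * (exp \<bar>h\<bar> - 1)"
proof -
  have "1 + h \<le> exp h" "1 - h \<le> exp (- h)"
    using exp_ge_add_one_self[of h] exp_ge_add_one_self[of "- h"] by simp_all
  then have "exp h - 1 - h \<le> h * (exp h - 1)"
    using mult_right_mono[of "1 - h" "exp (- h)" "exp h"]
    by (simp add: algebra_simps flip: exp_add)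
  also have "\<dots> \<le> \<bar>h\<bar> * (exp \<bar>h\<bar> - 1)"
  proof (cases "0 \<le> h")
    case False
    have "1 - exp h \<le> exp (- h) - 1"
      using \<open>1 + h \<le> exp h\<close> \<open>1 - h \<le> exp (- h)\<close> by linarith
    then show ?thesis
      using False mult_left_mono[of "1 - exp h" "exp (- h) - 1" "- h"]
      by (simp add: algebra_simps)
  qed simp
  finally show ?thesis
    using \<open>1 + h \<le> exp h\<close> by linarith
qed

text \<open>The chain rule along a trajectory: the error of the difference quotient is bounded
  uniformly on the cube by a quantity tending to 0.\<close>

lemma has_velocity_cube_exp:
  fixes s :: "real \<Rightarrow> 'a::euclidean_space"
  assumes deriv: "(s has_vector_derivative v) (at t within T)"
  shows "has_velocity cube_space (\<lambda>u. cube_exp (s u)) (cube_exp_deriv (s t) v) t T"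
proof -
  define K where "K = norm (One :: 'a)"
  have K: "norm x \<le> K" if "x \<in> unit_cube" for x :: 'a
    unfolding K_def using that by (intro norm_le_componentwise) (force simp: mem_box)
  \<comment> \<open>\<open>q\<close> is the difference quotient of the trajectory, \<open>r\<close>
    the error of the difference quotient of the lifted curve, and \<open>bound\<close> a majorant of
    \<open>r\<close> independent of the point of the cube.\<close>
  define q where "q u = (1 / (u - t)) *\<^sub>R (s u - s t)" for u
  define r where "r u = (\<lambda>x. (1 / (u - t)) * (cube_exp (s u) x - cube_exp (s t) x)
    - cube_exp_deriv (s t) v x)" for u
  define bound where "bound u =
    exp (norm (s t) * K) * (norm (q u) * K * (exp (norm (s u - s t) * K) - 1) + norm (q u - v) * K)"
    for u
  have diff: "(\<lambda>x. cube_exp (s u) x - cube_exp (s t) x) \<in> cube_functions" for u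
    using cube_functions_add[OF cube_exp_in_cube_functions[of "s u"]
        cube_functions_scale[OF cube_exp_in_cube_functions[of "s t"], of "-1"]] by simp
  have r: "r u \<in> cube_functions" for u
    using cube_functions_add[OF cube_functions_scale[OF diff, of "1 / (u - t)" u]
        cube_functions_scale[OF cube_exp_deriv_in_cube_functions[of "s t" v], of "-1"]]
    by (simp add: r_def)
  have r_eq: "((1 / (u - t)) \<odot>\<^bsub>cube_space\<^esub> (cube_exp (s u) \<ominus>\<^bsub>cube_space\<^esub> cube_exp (s t)))
      \<ominus>\<^bsub>cube_space\<^esub> cube_exp_deriv (s t) v = r u" for u
    unfolding r_def cube_space_simps
      minus_cube_space[OF cube_exp_in_cube_functions cube_exp_in_cube_functions]
    by (rule minus_cube_space[OF cube_functions_scale[OF diff] cube_exp_deriv_in_cube_functions])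
  have r_bound: "\<bar>r u x\<bar> \<le> bound u" if "u \<noteq> t" and x: "x \<in> unit_cube" for u x
  proof -
    define h where "h = (s u - s t) \<bullet> x"
    have h: "h = (u - t) * (q u \<bullet> x)"
      using \<open>u \<noteq> t\<close> by (simp add: h_def q_def)
    have inner_le: "\<bar>y \<bullet> x\<bar> \<le> norm y * K" for y
      using Cauchy_Schwarz_ineq2[of y x] mult_left_mono[OF K[OF x], of "norm y"] by simp
    have "s u \<bullet> x = s t \<bullet> x + h"
      by (simp add: h_def inner_diff_left)
    then have "r u x = exp (s t \<bullet> x) * ((exp h - 1) / (u - t) - v \<bullet> x)"
      using x by (simp add: r_def cube_exp_def cube_exp_deriv_def exp_add algebra_simps
          diff_divide_distrib)
    \<comment> \<open>The error splits into the remainder of the exponential and the error of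
      \<open>q\<close>.\<close>
    also have "(exp h - 1) / (u - t) - v \<bullet> x = (exp h - 1 - h) / (u - t) + (q u - v) \<bullet> x"
      using \<open>u \<noteq> t\<close> by (simp add: h inner_diff_left field_simps)
    finally have r_split: "\<bar>r u x\<bar>
        = exp (s t \<bullet> x) * \<bar>(exp h - 1 - h) / (u - t) + (q u - v) \<bullet> x\<bar>"
      by (simp add: abs_mult)
    have "\<bar>(exp h - 1 - h) / (u - t)\<bar> \<le> \<bar>h\<bar> * (exp \<bar>h\<bar> - 1) / \<bar>u - t\<bar>"
      unfolding abs_divide by (intro divide_right_mono exp_minus_linear_bound) simp
    also have "\<dots> = \<bar>q u \<bullet> x\<bar> * (exp \<bar>h\<bar> - 1)"
      using \<open>u \<noteq> t\<close> by (simp add: h abs_mult)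
    also have "\<dots> \<le> norm (q u) * K * (exp (norm (s u - s t) * K) - 1)"
      by (intro mult_mono inner_le) (use inner_le[of "s u - s t"] inner_le[of "q u"] in \<open>auto simp: h_def\<close>)
    finally have "\<bar>(exp h - 1 - h) / (u - t) + (q u - v) \<bullet> x\<bar>
        \<le> norm (q u) * K * (exp (norm (s u - s t) * K) - 1) + norm (q u - v) * K"
      using inner_le[of "q u - v"] by linarith
    moreover have "exp (s t \<bullet> x) \<le> exp (norm (s t) * K)"
      using inner_le[of "s t"] by simp
    ultimately show ?thesis
      unfolding r_split bound_def by (intro mult_mono) auto
  qed
  \<comment> \<open>The error of the linear approximation, divided by the time increment, is exactly
    \<open>norm (q u - v)\<close>.\<close>
  have q_lim: "(q \<longlongrightarrow> v) (at t within T)"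
  proof (rule LIM_zero_cancel, rule tendsto_norm_zero_cancel, rule Lim_transform_eventually)
    show "((\<lambda>u. norm (s u - s t - (u - t) *\<^sub>R v) / norm (u - t)) \<longlongrightarrow> 0) (at t within T)"
      using deriv by (simp add: has_vector_derivative_def has_derivative_iff_norm)
    have "norm (s u - s t - (u - t) *\<^sub>R v) / norm (u - t) = norm (q u - v)" if "u \<noteq> t" for u
    proof -
      have "s u - s t - (u - t) *\<^sub>R v = (u - t) *\<^sub>R (q u - v)"
        using that by (simp add: q_def scaleR_diff_right)
      then show ?thesis
        using that by simp
    qed
    then show "\<forall>\<^sub>F u in at t within T.
        norm (s u - s t - (u - t) *\<^sub>R v) / norm (u - t) = norm (q u - v)"
      by (simp add: eventually_at_filter)
  qed
  have s_lim: "(s \<longlongrightarrow> s t) (at t within T)"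
    using has_vector_derivative_continuous[OF deriv] by (simp add: continuous_within)
  have "(bound \<longlongrightarrow> exp (norm (s t) * K) *
      (norm v * K * (exp (norm (s t - s t) * K) - 1) + norm (v - v) * K)) (at t within T)"
    unfolding bound_def by (intro tendsto_intros q_lim s_lim)
  \<comment> \<open>Both summands of the limit vanish: one contains \<open>exp 0 - 1\<close>, the
    other \<open>norm 0\<close>.\<close>
  then have bound_lim: "(bound \<longlongrightarrow> 0) (at t within T)"
    by simp
  have "((\<lambda>u. ip_norm cube_space (r u)) \<longlongrightarrow> 0) (at t within T)"
  proof (rule tendsto_sandwich[OF _ _ tendsto_const bound_lim])
    show "\<forall>\<^sub>F u in at t within T. 0 \<le> ip_norm cube_space (r u)"
      using real_inner_product_space.ip_nonneg[OF real_inner_product_space_cube_space] r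
      by (auto simp: ip_norm_def simp del: cube_space_simps(5) intro!: always_eventually)
    \<comment> \<open>The filter excludes \<open>u = t\<close>, where \<open>r_bound\<close> gives
      nothing.\<close>
    show "\<forall>\<^sub>F u in at t within T. ip_norm cube_space (r u) \<le> bound u"
      unfolding eventually_at_filter
      by (auto intro!: always_eventually ip_norm_cube_space_le r r_bound)
  qed
  then show ?thesis
    unfolding has_velocity_def r_eq
    by (simp add: cube_exp_in_cube_functions cube_exp_deriv_in_cube_functions)
qed

section \<open>Linear independence of exponentials and linear extension\<close>

lemma sum_fun_apply: "sum f I x = (\<Sum>i\<in>I. f i x)"
  by (induction I rule: infinite_finite_induct) simp_all

interpretation fun_space: vector_space "\<lambda>(c::real) (g::'a \<Rightarrow> real) x. c * g x"
  by unfold_locales (auto simp: fun_eq_iff algebra_simps)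

interpretation fun_space_pair: vector_space_pair
  "\<lambda>(c::real) (g::'a \<Rightarrow> real) x. c * g x" "\<lambda>(c::real) (g::'a \<Rightarrow> real) x. c * g x" ..

text \<open>Bases and linear extensions are taken in the space of all real functions; this keeps
  spans of cube functions inside the carrier of \<open>cube_space\<close>.\<close>

lemma subspace_cube_functions: "fun_space.subspace cube_functions"
  by (auto simp: fun_space.subspace_def plus_fun_def zero_fun_def
      intro: cube_functions_zero cube_functions_add cube_functions_scale)

text \<open>
  Applying the differential operator \<open>\<partial>\<^sub>d - s \<bullet> d\<close> to a vanishing combination kills the
  term with frequency \<open>s\<close> and multiplies every other coefficient by \<open>(s' - s) \<bullet> d\<close>.
\<close>

lemma exp_sum_coeffs_zero:
  fixes I :: "'a::euclidean_space set"
  assumes "finite I" and "open U" and "U \<noteq> {}"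
    and "\<And>x. x \<in> U \<Longrightarrow> (\<Sum>s\<in>I. c s * exp (s \<bullet> x)) = 0"
  shows "\<forall>s\<in>I. c s = 0"
  using assms(1,4)
proof (induction I arbitrary: c rule: finite_induct)
  case (insert k I)
  have zero: "(\<Sum>s\<in>insert k I. c s * exp (s \<bullet> x)) = 0" if "x \<in> U" for x
    using insert.prems that by blast
  \<comment> \<open>The sum vanishes on the open set \<open>U\<close>, hence so does its derivative
    at every point of \<open>U\<close>.\<close>
  have deriv_zero: "(\<Sum>s\<in>insert k I. c s * (exp (s \<bullet> x) * (s \<bullet> d))) = 0" if "x \<in> U" for x d
  proof -
    have D: "((\<lambda>x. \<Sum>s\<in>insert k I. c s * exp (s \<bullet> x)) has_derivative
        (\<lambda>d. \<Sum>s\<in>insert k I. c s * (exp (s \<bullet> x) * (s \<bullet> d)))) (at x)"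
      by (auto intro!: derivative_eq_intros sum.cong)
    have D_zero: "((\<lambda>x. \<Sum>s\<in>insert k I. c s * exp (s \<bullet> x)) has_derivative (\<lambda>d. 0)) (at x)"
      by (rule has_derivative_transform_within_open[OF _ \<open>open U\<close> that, where f = "\<lambda>_. 0"])
         (auto simp only: has_derivative_const zero)
    show ?thesis
      by (rule fun_cong[OF has_derivative_unique[OF D D_zero]])
  qed
  have coeff: "\<forall>s\<in>I. c s * ((s - k) \<bullet> d) = 0" for d
  proof (rule insert.IH)
    fix x assume "x \<in> U"
    \<comment> \<open>The added term for \<open>k\<close> carries the factor
      \<open>(k - k) \<bullet> d = 0\<close>.\<close>
    have "(\<Sum>s\<in>I. c s * ((s - k) \<bullet> d) * exp (s \<bullet> x))
        = (\<Sum>s\<in>insert k I. c s * ((s - k) \<bullet> d) * exp (s \<bullet> x))"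
      using insert.hyps by simp
    also have "\<dots> = (\<Sum>s\<in>insert k I. c s * (exp (s \<bullet> x) * (s \<bullet> d)))
        - (k \<bullet> d) * (\<Sum>s\<in>insert k I. c s * exp (s \<bullet> x))"
      unfolding sum_distrib_left sum_subtractf[symmetric]
      by (intro sum.cong refl) (simp add: inner_diff_left algebra_simps)
    also have "\<dots> = 0"
      using zero[OF \<open>x \<in> U\<close>] deriv_zero[OF \<open>x \<in> U\<close>] by simp
    finally show "(\<Sum>s\<in>I. c s * ((s - k) \<bullet> d) * exp (s \<bullet> x)) = 0" .
  qed
  \<comment> \<open>The direction \<open>d = s - k\<close> makes the factor
    \<open>(s - k) \<bullet> d\<close> nonzero, since \<open>k\<close> is not in
    \<open>I\<close>.\<close>
  have c_I: "c s = 0" if "s \<in> I" for s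
    using coeff[of "s - k"] that insert.hyps by auto
  obtain x where "x \<in> U"
    using \<open>U \<noteq> {}\<close> by blast
  \<comment> \<open>Only the term of \<open>k\<close> is left in the sum, and its exponential is
    nonzero.\<close>
  with zero have "c k = 0"
    using insert.hyps c_I by fastforce
  with c_I show ?case
    by blast
qed simp

text \<open>On the interior of the cube \<open>cube_exp s\<close> is the true exponential, and the
  interior is a nonempty open set.\<close>

lemma independent_cube_exp: "fun_space.independent (range cube_exp)"
  unfolding fun_space.independent_explicit_module
proof (intro allI impI)
  fix E :: "('a \<Rightarrow> real) set" and c :: "('a \<Rightarrow> real) \<Rightarrow> real" and e
  assume "finite E" "E \<subseteq> range cube_exp" and zero: "(\<Sum>g\<in>E. (\<lambda>x. c g * g x)) = 0" and "e \<in> E"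
  then obtain I where I: "finite I" "E = cube_exp ` I"
    by (meson finite_subset_image)
  have "(\<Sum>s\<in>I. c (cube_exp s) * exp (s \<bullet> x)) = 0" if "x \<in> box 0 One" for x
  proof -
    have "x \<in> unit_cube"
      using that box_subset_cbox by blast
    then have "(\<Sum>s\<in>I. c (cube_exp s) * exp (s \<bullet> x)) = (\<Sum>s\<in>I. c (cube_exp s) * cube_exp s x)"
      by (simp add: cube_exp_def)
    also have "\<dots> = (\<Sum>g\<in>E. c g * g x)"
      unfolding I(2) by (simp add: sum.reindex inj_on_subset[OF inj_cube_exp])
    also have "\<dots> = (\<Sum>g\<in>E. (\<lambda>x. c g * g x)) x"
      by (simp add: sum_fun_apply)
    also have "\<dots> = 0"
      by (simp only: zero zero_fun_apply)
    finally show ?thesis .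
  qed
  then have "\<forall>s\<in>I. c (cube_exp s) = 0"
    by (rule exp_sum_coeffs_zero[OF I(1) open_box box_unit_cube_ne])
  then show "c e = 0"
    using I(2) \<open>e \<in> E\<close> by blast
qed

text \<open>Completes the independent exponentials to a basis of all functions and sends the added
  basis vectors to 0. The range then lies in the span of the prescribed values, hence in the
  carrier.\<close>

lemma linear_extension_cube_exp:
  fixes g :: "'a::euclidean_space \<Rightarrow> 'a \<Rightarrow> real"
  assumes "\<And>s. g s \<in> cube_functions"
  obtains L where "L \<in> linear_maps cube_space cube_space" and "\<And>s. L (cube_exp s) = g s"
proof -
  define L where "L = fun_space_pair.construct (range cube_exp) (\<lambda>e. g (the_inv cube_exp e))"
  have lin: "Vector_Spaces.linear (\<lambda>c g x. c * g x) (\<lambda>c g x. c * g x) L"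
    unfolding L_def by (rule fun_space_pair.linear_construct[OF independent_cube_exp])
  interpret L: Vector_Spaces.linear "\<lambda>(c::real) (g::'a \<Rightarrow> real) x. c * g x"
      "\<lambda>(c::real) (g::'a \<Rightarrow> real) x. c * g x" L
    by (rule lin)
  have "L h \<in> fun_space.span ((\<lambda>e. g (the_inv cube_exp e)) ` range cube_exp)" for h
    unfolding L_def by (rule fun_space_pair.construct_in_span[OF independent_cube_exp])
  also have "\<dots> \<subseteq> cube_functions"
    by (rule fun_space.span_minimal) (auto simp: assms subspace_cube_functions)
  finally have "L h \<in> cube_functions" for h .
  then have "L \<in> linear_maps cube_space cube_space"
    using L.add L.scale by (auto simp: module_hom_def plus_fun_def)
  moreover have "L (cube_exp s) = g s" for s
    unfolding L_def
    by (subst fun_space_pair.construct_basis[OF independent_cube_exp])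
       (simp_all add: the_inv_f_f inj_cube_exp)
  ultimately show ?thesis
    using that by blast
qed

section \<open>The operators of the lifted system\<close>

theorem proposition1:
  fixes S :: "(real^'n) set"
    and Act :: "(real^'m) set"
    and F :: "real^'n \<Rightarrow> real^'m \<Rightarrow> real^'n"
    and f0 :: "real^'n \<Rightarrow> real^'n"
    and f :: "'m \<Rightarrow> real^'n \<Rightarrow> real^'n"
  assumes lipschitz_f0: "\<exists>L. L-lipschitz_on S f0"
    and lipschitz_f: "\<And>j. \<exists>L. L-lipschitz_on S (f j)"
    and affine: "\<And>s a. s \<in> S \<Longrightarrow> a \<in> Act \<Longrightarrow> F s a = f0 s + (\<Sum>j\<in>UNIV. (a $ j) *\<^sub>R f j s)"
    and independent: "\<And>s. s \<in> S \<Longrightarrow> rank ((\<chi> i j. f j s $ i) :: real^'m^'n) = CARD('m)"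
  shows "\<exists>(Z :: (real^'n \<Rightarrow> real) ip_module) E A B C.
    real_inner_product_space Z \<and>
    E \<in> S \<rightarrow> carrier Z \<and> inj_on E S \<and>
    A \<in> linear_maps Z Z \<and>
    B \<in> linear_maps type_module Z \<and>
    C \<in> linear_maps Z (linear_map_space Z) \<and>
    (let M = (\<lambda>z. B \<oplus>\<^bsub>linear_map_space Z\<^esub> C z) in
      (\<forall>T s a t.
        is_interval T \<and> t \<in> T \<and> s ` T \<subseteq> S \<and> a t \<in> Act \<and>
        (s has_vector_derivative F (s t) (a t)) (at t within T) \<longrightarrow>
        has_velocity Z (\<lambda>u. E (s u)) (A (E (s t)) \<oplus>\<^bsub>Z\<^esub> M (E (s t)) (a t)) t T) \<and>
      (\<forall>z \<in> E ` S. inj (M z :: real^'m \<Rightarrow> (real^'n \<Rightarrow> real))) \<and>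
      (\<forall>z \<in> E ` S. positive_definite (gram_matrix Z (M z))))"
proof -
  let ?Z = "cube_space :: (real^'n \<Rightarrow> real) ip_module"
  obtain A where A: "A \<in> linear_maps ?Z ?Z" and A_exp: "\<And>s. A (cube_exp s) = cube_exp_deriv s (f0 s)"
    by (rule linear_extension_cube_exp[of "\<lambda>s. cube_exp_deriv s (f0 s)"])
       (auto simp: cube_exp_deriv_in_cube_functions)
  \<comment> \<open>One operator for each action coordinate; \<open>C z a\<close> will be their
    combination at \<open>z\<close> with the coordinates of \<open>a\<close> as weights.\<close>
  have "\<exists>D. D \<in> linear_maps ?Z ?Z \<and> (\<forall>s. D (cube_exp s) = cube_exp_deriv s (f j s))" for j
    by (rule linear_extension_cube_exp[of "\<lambda>s. cube_exp_deriv s (f j s)"])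
       (auto simp: cube_exp_deriv_in_cube_functions)
  then obtain D where D: "\<And>j. D j \<in> linear_maps ?Z ?Z"
    and D_exp: "\<And>j s. D j (cube_exp s) = cube_exp_deriv s (f j s)"
    by metis
  have D_in: "D j z \<in> cube_functions" if "z \<in> cube_functions" for j z
    using D[of j] that by (auto simp: module_hom_def)
  define B :: "real^'m \<Rightarrow> real^'n \<Rightarrow> real" where "B = (\<lambda>_ _. 0)"
  define C :: "(real^'n \<Rightarrow> real) \<Rightarrow> real^'m \<Rightarrow> real^'n \<Rightarrow> real"
    where "C z a = (\<lambda>x. \<Sum>j\<in>UNIV. a $ j * D j z x)" for z a
  define M where "M = (\<lambda>z. B \<oplus>\<^bsub>linear_map_space ?Z\<^esub> C z)"
  have C_maps: "C z \<in> linear_maps type_module ?Z" if "z \<in> cube_functions" for z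
    using D_in[OF that]
    by (auto simp: module_hom_def type_module_def C_def cube_functions_sum cube_functions_scale
        fun_eq_iff distrib_right sum.distrib sum_distrib_left mult.assoc)
  have C: "C \<in> linear_maps ?Z (linear_map_space ?Z)"
    using D C_maps
    by (auto simp: module_hom_def linear_map_space_def ring_of_type_algebra_def C_def fun_eq_iff
        distrib_left sum.distrib sum_distrib_left mult.left_commute)
  have M_eq: "M z = C z" for z
    by (simp add: M_def B_def linear_map_space_def)
  \<comment> \<open>\<open>cube_exp_deriv\<close> is linear in the direction, so the combination of
    derivatives is the derivative in the combined direction.\<close>
  have C_exp: "C (cube_exp s) a = cube_exp_deriv s (\<Sum>j\<in>UNIV. a $ j *\<^sub>R f j s)" for s a
    by (simp add: C_def D_exp cube_exp_deriv_def fun_eq_iff inner_sum_left sum_distrib_right mult.assoc)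
  have vel: "has_velocity ?Z (\<lambda>u. cube_exp (s u))
      (A (cube_exp (s t)) \<oplus>\<^bsub>?Z\<^esub> M (cube_exp (s t)) (a t)) t T"
    if "t \<in> T" "s ` T \<subseteq> S" "a t \<in> Act"
      "(s has_vector_derivative F (s t) (a t)) (at t within T)" for T s a t
  proof -
    \<comment> \<open>By the affine form of \<open>F\<close>, the drift and control directions add
      up to the velocity of the trajectory.\<close>
    have "A (cube_exp (s t)) \<oplus>\<^bsub>?Z\<^esub> M (cube_exp (s t)) (a t) = cube_exp_deriv (s t) (F (s t) (a t))"
      using affine[of "s t" "a t"] that
      by (auto simp: A_exp M_eq C_exp cube_exp_deriv_def fun_eq_iff inner_add_left distrib_right)
    then show ?thesis
      using has_velocity_cube_exp[OF that(4)] by simp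
  qed
  have inj: "inj (M (cube_exp s))" if "s \<in> S" for s
  proof -
    let ?G = "(\<chi> i j. f j s $ i) :: real^'m^'n"
    \<comment> \<open>Full column rank makes the action directions injective in \<open>a\<close>;
      composing with the injective derivative of the embedding gives injectivity of
      \<open>M\<close>.\<close>
    have "inj ((*v) ?G)"
      using independent[OF that] full_rank_injective by blast
    moreover have "?G *v a = (\<Sum>j\<in>UNIV. a $ j *\<^sub>R f j s)" for a
      by (simp add: vec_eq_iff matrix_vector_mult_def mult.commute)
    ultimately have "inj (\<lambda>a. cube_exp_deriv s (\<Sum>j\<in>UNIV. a $ j *\<^sub>R f j s))"
      using inj_compose[OF inj_cube_exp_deriv[of s], of "(*v) ?G"] by (simp add: comp_def)
    then show ?thesis
      by (simp add: M_eq C_exp[abs_def] C_exp)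
  qed
  have gram: "positive_definite (gram_matrix ?Z (M (cube_exp s)))" if "s \<in> S" for s
    using inj[OF that] C_maps[OF cube_exp_in_cube_functions]
    by (auto simp: M_eq intro: real_inner_product_space.positive_definite_gram_matrix
        real_inner_product_space_cube_space)
  have B: "B \<in> linear_maps type_module ?Z"
    by (auto simp: B_def module_hom_def cube_functions_zero)
  show ?thesis
    unfolding Let_def
    using A B C inj gram vel unfolding M_def
    by (intro exI[of _ ?Z] exI[of _ cube_exp] exI[of _ A] exI[of _ B] exI[of _ C])
       (auto simp: real_inner_product_space_cube_space cube_exp_in_cube_functions
          inj_on_subset[OF inj_cube_exp])
qed

end
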